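(* $p^2(Q_3)=3$.
   Context: For $n\ge 1$, $Q_n$ is the $n$-dimensional hypercube: the graph with vertex set $\{0,1\}^n$ and edges between vertices differing in exactly one coordinate. An embedding of $Q_d$ in $Q_n$ is a subgraph of $Q_n$ isomorphic to $Q_d$ (equivalently, a $d$-dimensional subcube, obtained by fixing $n-d$ coordinates and letting the other $d$ vary). For $d\ge i\ge 1$, $p^i(Q_d)$ denotes the largest integer $r$ such that for every $n\ge d$ one can assign one of $r$ colors to each embedding of $Q_i$ in $Q_n$ so that every embedding of $Q_d$ in $Q_n$ contains an embedding of $Q_i$ of every one of the $r$ colors. *)

theory Defs
  imports "Graph_Theory.Graph_Theory"
begin

text \<open>
  As in the Graph Theory entry, an undirected graph is a symmetric digraph: an edge
  between u and v is the pair of arcs (u, v) and (v, u).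
\<close>

definition hypercube :: "nat \<Rightarrow> bool list pair_pre_digraph" where
  "hypercube n = \<lparr> pverts = {v. length v = n},
     parcs = {(u, v). length u = n \<and> length v = n \<and> (\<exists>!i. i < n \<and> u ! i \<noteq> v ! i)} \<rparr>"

lemma pair_graph_hypercube: "pair_graph (hypercube n)"
proof
  have fin: "finite {v :: bool list. length v = n}"
    using finite_lists_length_eq[of "UNIV :: bool set" n] by simp
  then show "finite (pverts (hypercube n))"
    by (simp add: hypercube_def)
  have "parcs (hypercube n) \<subseteq> {v. length v = n} \<times> {v. length v = n}"
    by (auto simp: hypercube_def)
  then show "finite (parcs (hypercube n))"
    by (rule finite_subset) (simp add: fin)
  show "symmetric (with_proj (hypercube n))"
    unfolding symmetric_def
  proof (rule symI)
    fix u v assume "(u, v) \<in> arcs_ends (with_proj (hypercube n))"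
    moreover have "(\<exists>!i. i < n \<and> u ! i \<noteq> v ! i) \<longleftrightarrow> (\<exists>!i. i < n \<and> v ! i \<noteq> u ! i)"
      by (simp only: eq_commute)
    ultimately show "(v, u) \<in> arcs_ends (with_proj (hypercube n))"
      by (simp only: with_proj_simps hypercube_def pair_pre_digraph.simps mem_Collect_eq split_conv)
  qed
next
  fix e assume "e \<in> parcs (hypercube n)"
  then have "length (fst e) = n \<and> length (snd e) = n \<and> fst e \<noteq> snd e"
    unfolding hypercube_def by (cases e) force
  then show "fst e \<in> pverts (hypercube n)" "snd e \<in> pverts (hypercube n)" "fst e \<noteq> snd e"
    by (simp_all add: hypercube_def)
qed

text \<open>
  The embeddings of the d-cube in the n-cube, as subgraphs. A subdigraph isomorphic to
  the (symmetric) d-cube is itself symmetric, so these are subgraphs in the undirected sense.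
\<close>

definition cube_embeddings :: "nat \<Rightarrow> nat \<Rightarrow> bool list pair_pre_digraph set" where
  "cube_embeddings d n = {H. subgraph (with_proj H) (with_proj (hypercube n)) \<and>
     digraph_iso (with_proj (hypercube d)) (with_proj H)}"

definition polychromatic_colouring ::
  "nat \<Rightarrow> nat \<Rightarrow> nat \<Rightarrow> nat \<Rightarrow> (bool list pair_pre_digraph \<Rightarrow> nat) \<Rightarrow> bool" where
  "polychromatic_colouring i d n r c \<longleftrightarrow>
     (\<forall>K \<in> cube_embeddings i n. c K < r) \<and>
     (\<forall>H \<in> cube_embeddings d n. \<forall>k < r. \<exists>K \<in> cube_embeddings i n.
        subgraph (with_proj K) (with_proj H) \<and> c K = k)"

text \<open>
  The number p^i(Q_d), intended for 1 \<le> i \<le> d. There r = 0 is never admissible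
  (no embedding of the i-cube could receive a colour), and the admissible r are bounded by
  the number of i-cubes in the d-cube.
\<close>

definition polychromatic_number :: "nat \<Rightarrow> nat \<Rightarrow> nat" where
  "polychromatic_number i d =
     (GREATEST r. \<forall>n \<ge> d. \<exists>c. polychromatic_colouring i d n r c)"

end

theory Submission
  imports Defs "HOL-Library.Ramsey"
begin

text \<open>
  By rigidity of the cube (two vertices at distance two have exactly two common neighbours), every
  embedding of a d-cube is a subcube, so colouring squares means colouring pairs of a free
  coordinate set T and a set C of coordinates fixed to one.

  Three colours: a square with a, b, c ones before, between and after its two free coordinates
  gets the colour \<open>\<lfloor>(b + 1) / 2\<rfloor> + 2 (a + c)\<close> modulo 3.

  No four colours: by Ramsey's theorem, applied to the sets \<open>T \<union> C\<close>, there are five coordinates on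
  which the colour depends on (a, b, c) only. For such a colouring the 3-cubes with at most two
  ones already give a contradiction.
\<close>

section \<open>Embedded cubes are subcubes\<close>

text \<open>Both bounds come down to a function \<open>F\<close> of three counts: if the free
  coordinates of a 3-cube cut its ones into gaps of sizes a, b, c, d, its six squares have counts
  computed from these numbers alone, so the geometry disappears once a colouring depends only on
  counts. The obstacle in the upper bound is that \<open>T \<union> C\<close> does not determine a
  square, so a colouring of squares is not a colouring of sets. With (a, b, c) prescribed the union
  does determine it. Each of the finitely many count vectors therefore gives its own colouring of
  sets of size a + b + c + 2, and these are made constant one after another. Five coordinates are
  three free ones plus two ones. Cubes with at most one one would not give the contradiction: their
  conditions for four colours are solved by \<open>F 1 0 1 = F 0 2 0 = F 0 0 0\<close>,
  \<open>F 1 1 0 = F 0 1 1 = F 0 1 0\<close>, \<open>F 0 0 2 = F 1 0 0\<close> and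
  \<open>F 2 0 0 = F 0 0 1\<close>, with \<open>F 0 0 0\<close>, \<open>F 1 0 0\<close>,
  \<open>F 0 1 0\<close>, \<open>F 0 0 1\<close> distinct.\<close>

lemma sym_diff_common_neighbour:
  assumes "sym_diff P X = {a}" "sym_diff P Y = {b}" "a \<noteq> b"
    and "sym_diff X Q = {x}" "sym_diff Y Q = {y}" "Q \<noteq> P"
  shows "Q = sym_diff P {a, b}"
proof -
  have X: "X = sym_diff P {a}" and Y: "Y = sym_diff P {b}" using assms(1,2) by blast+
  have Q: "Q = sym_diff X {x}" "Q = sym_diff Y {y}" using assms(4,5) by blast+
  have "sym_diff P Q = sym_diff {a} {x}" "sym_diff P Q = sym_diff {b} {y}" 
    using X Y Q by blast+
  moreover have "sym_diff P Q \<noteq> {}" using assms(6) by blast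
  ultimately have "sym_diff P Q = {a, x}" "sym_diff P Q = {b, y}"
    by (metis empty_Diff insert_Diff_if Un_empty_right Diff_cancel singletonD insert_is_Un)+
  then have "sym_diff P Q = {a, b}" using \<open>a \<noteq> b\<close> by (metis doubleton_eq_iff)
  then show ?thesis by blast
qed

lemma sym_diff_insert2:
  assumes "a \<notin> Y" "b \<notin> Y"
  shows "sym_diff (sym_diff P Y) {a, b} = sym_diff P (insert a (insert b Y))"
proof (rule set_eqI)
  fix x show "x \<in> sym_diff (sym_diff P Y) {a, b} \<longleftrightarrow> x \<in> sym_diff P (insert a (insert b Y))"
    using assms by (cases "x = a"; cases "x = b") auto
qed

text \<open>Induction on \<open>A\<close>, removing two elements i and j: the images of
  \<open>A - {i}\<close> and \<open>A - {j}\<close> have only two common neighbours, and injectivity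
  excludes the image of \<open>A - {i, j}\<close>, which leaves the other one.\<close>

lemma cube_hom_rigid:
  fixes \<psi> :: "'a set \<Rightarrow> 'b set"
  assumes "finite D" and inj: "inj_on \<psi> (Pow D)"
    and adj: "\<And>A i. A \<subseteq> D \<Longrightarrow> i \<in> D - A \<Longrightarrow> \<exists>j. sym_diff (\<psi> A) (\<psi> (insert i A)) = {j}"
  shows "\<exists>\<sigma>. inj_on \<sigma> D \<and> (\<forall>A. A \<subseteq> D \<longrightarrow> \<psi> A = sym_diff (\<psi> {}) (\<sigma> ` A))"
proof -
  have "\<forall>i\<in>D. \<exists>j. sym_diff (\<psi> {}) (\<psi> {i}) = {j}"
    using adj[of "{}"] by simp
  then obtain \<sigma> where \<sigma>: "\<And>i. i \<in> D \<Longrightarrow> sym_diff (\<psi> {}) (\<psi> {i}) = {\<sigma> i}"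
    by metis
  have \<sigma>': "\<psi> {i} = sym_diff (\<psi> {}) {\<sigma> i}" if "i \<in> D" for i
    using \<sigma>[OF that] by blast
  have inj\<sigma>: "inj_on \<sigma> D"
  proof (rule inj_onI)
    fix i j assume ij: "i \<in> D" "j \<in> D" "\<sigma> i = \<sigma> j"
    then have "\<psi> {i} = \<psi> {j}" using \<sigma>' by simp
    then show "i = j" using inj_onD[OF inj, of "{i}" "{j}"] ij by simp
  qed
  have "\<psi> A = sym_diff (\<psi> {}) (\<sigma> ` A)" if "A \<subseteq> D" for A
    using finite_subset[OF that \<open>finite D\<close>] that
  proof (induction A rule: finite_psubset_induct)
    case (psubset A)
    show ?case
    proof (cases "\<exists>i j. i \<in> A \<and> j \<in> A \<and> i \<noteq> j")
      case False
      then consider "A = {}" | i where "A = {i}" by blast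
      then show ?thesis using \<sigma>' psubset.prems by cases auto
    next
      case True
      then obtain i j where ij: "i \<in> A" "j \<in> A" "i \<noteq> j" by blast
      define W where "W = A - {i, j}"
      have A: "A = insert i (insert j W)" "A = insert j (insert i W)"
        and W: "W \<subset> A" "insert i W \<subset> A" "insert j W \<subset> A" "i \<notin> W" "j \<notin> W"
        using ij by (auto simp: W_def)
      have D: "i \<in> D" "j \<in> D" "W \<subseteq> D" using psubset.prems ij W by auto
      have nW: "\<sigma> i \<notin> \<sigma> ` W" "\<sigma> j \<notin> \<sigma> ` W" "\<sigma> i \<noteq> \<sigma> j"
        using inj\<sigma> D W ij by (auto dest: inj_onD)
      have IH: "\<psi> W = sym_diff (\<psi> {}) (\<sigma> ` W)"
        "\<psi> (insert i W) = sym_diff (\<psi> {}) (insert (\<sigma> i) (\<sigma> ` W))"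
        "\<psi> (insert j W) = sym_diff (\<psi> {}) (insert (\<sigma> j) (\<sigma> ` W))"
        using psubset.IH[OF W(1)] psubset.IH[OF W(2)] psubset.IH[OF W(3)] D
        by simp_all
      have i: "sym_diff (\<psi> W) (\<psi> (insert i W)) = {\<sigma> i}"
        and j: "sym_diff (\<psi> W) (\<psi> (insert j W)) = {\<sigma> j}"
        unfolding IH using nW by auto
      obtain x where x: "sym_diff (\<psi> (insert i W)) (\<psi> A) = {x}"
        using adj[of "insert i W" j] D W ij A(2) by auto
      obtain y where y: "sym_diff (\<psi> (insert j W)) (\<psi> A) = {y}"
        using adj[of "insert j W" i] D W ij A(1) by auto
      have "\<psi> A \<noteq> \<psi> W"
        using inj_onD[OF inj, of A W] psubset.prems D W by auto
      then have "\<psi> A = sym_diff (\<psi> W) {\<sigma> i, \<sigma> j}"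
        by (rule sym_diff_common_neighbour[OF i j nW(3) x y])
      also have "\<dots> = sym_diff (\<psi> {}) (insert (\<sigma> i) (insert (\<sigma> j) (\<sigma> ` W)))"
        unfolding IH(1) by (rule sym_diff_insert2) (use nW in auto)
      also have "insert (\<sigma> i) (insert (\<sigma> j) (\<sigma> ` W)) = \<sigma> ` A"
        by (subst A(1)) simp
      finally show ?thesis .
    qed
  qed
  with inj\<sigma> show ?thesis by (intro exI[of _ \<sigma>] conjI allI impI)
qed

section \<open>Vertices as coordinate sets, subcubes as pairs of sets\<close>

definition vec :: "nat \<Rightarrow> nat set \<Rightarrow> bool list" where
  "vec n A = map (\<lambda>i. i \<in> A) [0..<n]"

lemma length_vec [simp]: "length (vec n A) = n"
  by (simp add: vec_def)

lemma nth_vec [simp]: "i < n \<Longrightarrow> vec n A ! i \<longleftrightarrow> i \<in> A"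
  by (simp add: vec_def)

lemma vec_eq_iff: "A \<subseteq> {..<n} \<Longrightarrow> B \<subseteq> {..<n} \<Longrightarrow> vec n A = vec n B \<longleftrightarrow> A = B"
  by (auto simp: list_eq_iff_nth_eq)

lemma pverts_hypercube: "pverts (hypercube n) = vec n ` Pow {..<n}"
proof -
  have "v = vec n {i. i < n \<and> v ! i}" if "length v = n" for v
    using that by (auto simp: list_eq_iff_nth_eq)
  then show ?thesis by (fastforce simp: hypercube_def)
qed

lemma parcs_hypercube_iff:
  assumes "A \<subseteq> {..<n}" "B \<subseteq> {..<n}"
  shows "(vec n A, vec n B) \<in> parcs (hypercube n) \<longleftrightarrow> (\<exists>j. sym_diff A B = {j})"
proof -
  have "(i < n \<and> vec n A ! i \<noteq> vec n B ! i) \<longleftrightarrow> i \<in> sym_diff A B" for i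
    using assms by auto
  then have "(vec n A, vec n B) \<in> parcs (hypercube n) \<longleftrightarrow> (\<exists>!i. i \<in> sym_diff A B)"
    by (simp add: hypercube_def)
  then show ?thesis by (auto simp: set_eq_iff Ex1_def)
qed

text \<open>Taken as an induced subgraph, so that containment of subcubes can be decided on vertices
  alone.\<close>

definition subcube :: "nat \<Rightarrow> nat set \<Rightarrow> nat set \<Rightarrow> bool list pair_pre_digraph" where
  "subcube n S B = (let V = (\<lambda>X. vec n (B \<union> X)) ` Pow S
     in \<lparr> pverts = V, parcs = parcs (hypercube n) \<inter> V \<times> V \<rparr>)"

lemma pverts_subcube: "pverts (subcube n S B) = (\<lambda>X. vec n (B \<union> X)) ` Pow S"
  and parcs_subcube: "parcs (subcube n S B) =
    parcs (hypercube n) \<inter> pverts (subcube n S B) \<times> pverts (subcube n S B)"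
  by (simp_all add: subcube_def Let_def)

text \<open>S holds the free coordinates and B the coordinates fixed to one.\<close>

definition is_face :: "nat \<Rightarrow> nat \<Rightarrow> nat set \<Rightarrow> nat set \<Rightarrow> bool" where
  "is_face d n S B \<longleftrightarrow> S \<subseteq> {..<n} \<and> card S = d \<and> B \<subseteq> {..<n} - S"

lemma wf_hypercube: "wf_digraph (with_proj (hypercube n))"
proof -
  interpret pair_graph "hypercube n" by (rule pair_graph_hypercube)
  show ?thesis by unfold_locales
qed

lemma wf_subcube: "wf_digraph (with_proj (subcube n S B))"
  by unfold_locales (auto simp: parcs_subcube)

text \<open>A general isomorphism also carries maps for arcs, tails and heads. When arcs are pairs,
  the arc map is forced to be \<open>map_prod f f\<close>, so an injective vertex map holds all the
  information. Well-formedness puts the arcs of \<open>G\<close> inside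
  \<open>pverts G \<times> pverts G\<close>, where \<open>map_prod f f\<close> inherits
  injectivity.\<close>

lemma digraph_iso_with_proj_iff:
  assumes "wf_digraph (with_proj G)"
  shows "digraph_iso (with_proj G) (with_proj H) \<longleftrightarrow>
    (\<exists>f. inj_on f (pverts G) \<and> pverts H = f ` pverts G \<and> parcs H = map_prod f f ` parcs G)"
proof
  assume "digraph_iso (with_proj G) (with_proj H)"
  then obtain h where h: "pre_digraph.digraph_isomorphism (with_proj G) h"
    and H: "with_proj H = app_iso h (with_proj G)"
    by (auto simp: digraph_iso_def)
  have tail: "iso_tail h = fst" and head: "iso_head h = snd"
    and V: "pverts H = iso_verts h ` pverts G" and E: "parcs H = iso_arcs h ` parcs G"
    using H by (auto simp: app_iso_def with_proj_def)
  have "iso_arcs h a = map_prod (iso_verts h) (iso_verts h) a" if "a \<in> parcs G" for a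
    using h that unfolding pre_digraph.digraph_isomorphism_def tail head
    by (cases a) (auto simp: prod_eq_iff)
  then have "parcs H = map_prod (iso_verts h) (iso_verts h) ` parcs G"
    using E by (auto intro!: image_cong)
  then show "\<exists>f. inj_on f (pverts G) \<and> pverts H = f ` pverts G \<and> parcs H = map_prod f f ` parcs G"
    using h V unfolding pre_digraph.digraph_isomorphism_def by auto
next
  assume "\<exists>f. inj_on f (pverts G) \<and> pverts H = f ` pverts G \<and> parcs H = map_prod f f ` parcs G"
  then obtain f where f: "inj_on f (pverts G)" "pverts H = f ` pverts G"
    "parcs H = map_prod f f ` parcs G" by blast
  have sub: "parcs G \<subseteq> pverts G \<times> pverts G"
    using wf_digraph.head_in_verts[OF assms] wf_digraph.tail_in_verts[OF assms] by force
  define h where "h = \<lparr>iso_verts = f, iso_arcs = map_prod f f, iso_head = snd, iso_tail = fst\<rparr>"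
  have "inj_on (map_prod f f) (parcs G)"
    using map_prod_inj_on[OF f(1) f(1)] sub by (rule inj_on_subset)
  then have "pre_digraph.digraph_isomorphism (with_proj G) h"
    using assms f(1) by (simp add: pre_digraph.digraph_isomorphism_def h_def)
  moreover have "with_proj H = app_iso h (with_proj G)"
    using f by (simp add: app_iso_def h_def with_proj_def)
  ultimately show "digraph_iso (with_proj G) (with_proj H)"
    by (auto simp: digraph_iso_def)
qed

lemma map_prod_image_eqI:
  assumes "\<And>u v. u \<in> V \<Longrightarrow> v \<in> V \<Longrightarrow> (f u, f v) \<in> E' \<longleftrightarrow> (u, v) \<in> E" "E \<subseteq> V \<times> V"
  shows "map_prod f f ` E = E' \<inter> f ` V \<times> f ` V"
  using assms by (force simp: image_iff)

text \<open>Serves both directions of the classification: \<psi> is the vertex map \<open>f\<close>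
  read on coordinate sets, and since subcubes are induced, range and adjacency of \<psi> settle the
  graph structure.\<close>

lemma subcube_iso:
  assumes \<psi>: "inj_on \<psi> (Pow {..<d})" "\<And>A. A \<subseteq> {..<d} \<Longrightarrow> \<psi> A \<subseteq> {..<n}"
    and range: "\<psi> ` Pow {..<d} = (\<union>) B ` Pow S"
    and f: "\<And>A. A \<subseteq> {..<d} \<Longrightarrow> f (vec d A) = vec n (\<psi> A)"
    and adj: "\<And>A A'. A \<subseteq> {..<d} \<Longrightarrow> A' \<subseteq> {..<d} \<Longrightarrow>
      (\<exists>j. sym_diff (\<psi> A) (\<psi> A') = {j}) \<longleftrightarrow> (\<exists>j. sym_diff A A' = {j})"
  shows "inj_on f (pverts (hypercube d))"
    and "pverts (subcube n S B) = f ` pverts (hypercube d)"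
    and "parcs (subcube n S B) = map_prod f f ` parcs (hypercube d)"
proof -
  show "inj_on f (pverts (hypercube d))"
  proof (rule inj_onI)
    fix u v assume uv: "u \<in> pverts (hypercube d)" "v \<in> pverts (hypercube d)" "f u = f v"
    then obtain A A' where A: "u = vec d A" "v = vec d A'" "A \<subseteq> {..<d}" "A' \<subseteq> {..<d}"
      unfolding pverts_hypercube by blast
    have "\<psi> A = \<psi> A'"
      using uv(3) A \<psi>(2) by (simp add: f vec_eq_iff)
    then show "u = v" using inj_onD[OF \<psi>(1), of A A'] A by simp
  qed
  have "pverts (subcube n S B) = vec n ` (\<union>) B ` Pow S"
    by (simp add: pverts_subcube image_image)
  also have "\<dots> = f ` pverts (hypercube d)"
    unfolding range[symmetric] pverts_hypercube by (auto simp: f image_image)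
  finally show V: "pverts (subcube n S B) = f ` pverts (hypercube d)" .
  have "(f u, f v) \<in> parcs (hypercube n) \<longleftrightarrow> (u, v) \<in> parcs (hypercube d)"
    if uv: "u \<in> pverts (hypercube d)" "v \<in> pverts (hypercube d)" for u v
  proof -
    obtain A A' where "u = vec d A" "v = vec d A'" "A \<subseteq> {..<d}" "A' \<subseteq> {..<d}"
      using uv unfolding pverts_hypercube by blast
    then show ?thesis using \<psi>(2) adj[of A A'] by (simp add: f parcs_hypercube_iff)
  qed
  moreover have "parcs (hypercube d) \<subseteq> pverts (hypercube d) \<times> pverts (hypercube d)"
    by (auto simp: hypercube_def)
  ultimately show "parcs (subcube n S B) = map_prod f f ` parcs (hypercube d)"
    unfolding parcs_subcube V by (rule map_prod_image_eqI[of "pverts (hypercube d)" f "parcs (hypercube n)", symmetric])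
qed

lemma subgraph_hypercube_iff:
  "subgraph (with_proj (subcube n S B)) (with_proj (hypercube n)) \<longleftrightarrow>
    pverts (subcube n S B) \<subseteq> pverts (hypercube n)"
  using wf_subcube wf_hypercube by (auto simp: subgraph_def compatible_def parcs_subcube)

lemma image_sym_diff:
  assumes "inj_on f D" "A \<subseteq> D" "A' \<subseteq> D"
  shows "f ` sym_diff A A' = sym_diff (f ` A) (f ` A')"
proof -
  have "A - A' \<subseteq> D" "A' - A \<subseteq> D" using assms(2,3) by auto
  then show ?thesis
    using assms by (simp only: image_Un inj_on_image_set_diff[OF assms(1)])
qed

lemma sym_diff_Un_left:
  assumes "B \<inter> P = {}" "B \<inter> Q = {}"
  shows "sym_diff (B \<union> P) (B \<union> Q) = sym_diff P Q"
  using assms by blast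

lemma sym_diff_sym_diff: "sym_diff (sym_diff B P) (sym_diff B Q) = sym_diff P Q"
  by blast

lemma subcube_in_cube_embeddings:
  assumes "is_face d n S B"
  shows "subcube n S B \<in> cube_embeddings d n"
proof -
  have S: "S \<subseteq> {..<n}" "card S = d" "B \<subseteq> {..<n} - S"
    using assms by (auto simp: is_face_def)
  then have "finite S" using finite_subset by blast
  then obtain e where e: "bij_betw e {..<d} S"
    using S(2) finite_same_card_bij[of "{..<d}" S] by auto
  then have inj: "inj_on e {..<d}" and im: "e ` {..<d} = S"
    by (auto simp: bij_betw_def)
  define \<psi> where "\<psi> A = B \<union> e ` A" for A
  define f where "f v = vec n (\<psi> {i. i < d \<and> v ! i})" for v
  have disj: "B \<inter> e ` A = {}" if "A \<subseteq> {..<d}" for A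
    using that S(3) im by blast
  have diff: "sym_diff (\<psi> A) (\<psi> A') = e ` sym_diff A A'" if "A \<subseteq> {..<d}" "A' \<subseteq> {..<d}" for A A'
    unfolding \<psi>_def sym_diff_Un_left[OF disj[OF that(1)] disj[OF that(2)]]
    by (rule image_sym_diff[OF inj that, symmetric])
  have eD: "\<psi> A = \<psi> A' \<longleftrightarrow> A = A'" if "A \<subseteq> {..<d}" "A' \<subseteq> {..<d}" for A A'
  proof -
    have "\<psi> A = \<psi> A' \<longleftrightarrow> sym_diff (\<psi> A) (\<psi> A') = {}" by blast
    also have "\<dots> \<longleftrightarrow> sym_diff A A' = {}" unfolding diff[OF that] by simp
    also have "\<dots> \<longleftrightarrow> A = A'" by blast
    finally show ?thesis .
  qed
  have adj: "(\<exists>j. sym_diff (\<psi> A) (\<psi> A') = {j}) \<longleftrightarrow> (\<exists>j. sym_diff A A' = {j})"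
    if "A \<subseteq> {..<d}" "A' \<subseteq> {..<d}" for A A'
  proof -
    have "card (e ` sym_diff A A') = card (sym_diff A A')"
      using that by (intro card_image inj_on_subset[OF inj]) auto
    then show ?thesis unfolding diff[OF that] by (metis card_1_singleton_iff)
  qed
  have f: "f (vec d A) = vec n (\<psi> A)" if "A \<subseteq> {..<d}" for A
  proof -
    have "{i. i < d \<and> vec d A ! i} = A" using that by auto
    then show ?thesis by (simp add: f_def)
  qed
  have range: "\<psi> ` Pow {..<d} = (\<union>) B ` Pow S"
    unfolding \<psi>_def image_Pow_surj[OF im, symmetric] image_image ..
  have inj\<psi>: "inj_on \<psi> (Pow {..<d})" using eD by (auto intro: inj_onI)
  have \<psi>n: "\<psi> A \<subseteq> {..<n}" if "A \<subseteq> {..<d}" for A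
    using image_mono[OF that, of e] S unfolding im \<psi>_def by blast
  have "digraph_iso (with_proj (hypercube d)) (with_proj (subcube n S B))"
    unfolding digraph_iso_with_proj_iff[OF wf_hypercube]
    by (intro exI[of _ f] conjI subcube_iso[OF inj\<psi> \<psi>n range f adj])
  moreover have "pverts (subcube n S B) \<subseteq> pverts (hypercube n)"
    by (auto simp: pverts_subcube hypercube_def)
  ultimately show ?thesis
    by (simp add: cube_embeddings_def subgraph_hypercube_iff)
qed

lemma cube_embedding_is_subcube:
  assumes "H \<in> cube_embeddings d n"
  obtains S B where "is_face d n S B" "H = subcube n S B"
proof -
  obtain f where f: "inj_on f (pverts (hypercube d))" "pverts H = f ` pverts (hypercube d)"
      "parcs H = map_prod f f ` parcs (hypercube d)"
    and sub: "pverts H \<subseteq> pverts (hypercube n)" "parcs H \<subseteq> parcs (hypercube n)"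
    using assms unfolding cube_embeddings_def digraph_iso_with_proj_iff[OF wf_hypercube]
    by (auto simp: subgraph_def)
  define \<psi> where "\<psi> A = {i. i < n \<and> f (vec d A) ! i}" for A
  have \<psi>n: "\<psi> A \<subseteq> {..<n}" for A by (auto simp: \<psi>_def)
  have f\<psi>: "f (vec d A) = vec n (\<psi> A)" if "A \<subseteq> {..<d}" for A
  proof -
    have "f (vec d A) \<in> pverts (hypercube n)"
      using that f(2) sub(1) by (auto simp: pverts_hypercube)
    then have "length (f (vec d A)) = n" by (simp add: hypercube_def)
    then show ?thesis by (auto simp: list_eq_iff_nth_eq \<psi>_def)
  qed
  have inj: "inj_on \<psi> (Pow {..<d})"
  proof (rule inj_onI)
    fix A A' assume A: "A \<in> Pow {..<d}" "A' \<in> Pow {..<d}" "\<psi> A = \<psi> A'"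
    then have "f (vec d A) = f (vec d A')" by (simp add: f\<psi>)
    then have "vec d A = vec d A'"
      by (rule inj_onD[OF f(1)]) (use A in \<open>auto simp: pverts_hypercube\<close>)
    then show "A = A'" using A by (simp add: vec_eq_iff)
  qed
  have step: "\<exists>j. sym_diff (\<psi> A) (\<psi> (insert i A)) = {j}" if "A \<subseteq> {..<d}" "i \<in> {..<d} - A" for A i
  proof -
    have "sym_diff A (insert i A) = {i}" using that by auto
    then have "(vec d A, vec d (insert i A)) \<in> parcs (hypercube d)"
      using that parcs_hypercube_iff[of A d "insert i A"] by auto
    then have "map_prod f f (vec d A, vec d (insert i A)) \<in> parcs (hypercube n)"
      using f(3) sub(2) by blast
    then show ?thesis
      using that \<psi>n by (simp add: f\<psi> parcs_hypercube_iff)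
  qed
  obtain \<sigma> where inj\<sigma>: "inj_on \<sigma> {..<d}"
    and \<sigma>: "\<And>A. A \<subseteq> {..<d} \<Longrightarrow> \<psi> A = sym_diff (\<psi> {}) (\<sigma> ` A)"
    using cube_hom_rigid[OF finite_lessThan inj step] by auto
  define S where "S = \<sigma> ` {..<d}"
  \<comment> \<open>The image \<open>\<psi> {}\<close> of the origin may be any vertex of the
    subcube; its ones in free directions are stripped off, which leaves the fixed ones.\<close>
  define B where "B = \<psi> {} - S"
  have "\<sigma> i \<in> {..<n}" if "i < d" for i
    using \<sigma>[of "{i}"] \<psi>n[of "{}"] \<psi>n[of "{i}"] that by auto
  then have S: "S \<subseteq> {..<n}" by (auto simp: S_def)
  have face: "is_face d n S B"
    using S \<psi>n inj\<sigma> by (auto simp: is_face_def B_def S_def card_image)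
  have diff: "sym_diff (\<psi> A) (\<psi> A') = \<sigma> ` sym_diff A A'" if "A \<subseteq> {..<d}" "A' \<subseteq> {..<d}" for A A'
    using that by (simp only: \<sigma> sym_diff_sym_diff image_sym_diff[OF inj\<sigma>])
  have adj: "(\<exists>j. sym_diff (\<psi> A) (\<psi> A') = {j}) \<longleftrightarrow> (\<exists>j. sym_diff A A' = {j})"
    if "A \<subseteq> {..<d}" "A' \<subseteq> {..<d}" for A A'
  proof -
    have "card (\<sigma> ` sym_diff A A') = card (sym_diff A A')"
      using that by (intro card_image inj_on_subset[OF inj\<sigma>]) auto
    then show ?thesis unfolding diff[OF that] by (metis card_1_singleton_iff)
  qed
  have range: "\<psi> ` Pow {..<d} = (\<union>) B ` Pow S"
  proof (intro equalityI subsetI)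
    fix x assume "x \<in> \<psi> ` Pow {..<d}"
    then obtain A where A: "A \<subseteq> {..<d}" "x = \<psi> A" by auto
    then have "\<sigma> ` A \<subseteq> S" by (auto simp: S_def)
    then have "x = B \<union> (x \<inter> S)" unfolding A(2) \<sigma>[OF A(1)] B_def by blast
    then show "x \<in> (\<union>) B ` Pow S" by blast
  next
    fix x assume "x \<in> (\<union>) B ` Pow S"
    then obtain X where X: "x = B \<union> X" "X \<subseteq> S" by auto
    \<comment> \<open>This is the set of directions in which \<open>x\<close> differs from
      \<open>\<psi> {}\<close>: outside \<open>S\<close> both agree with \<open>B\<close>.\<close>
    then have "sym_diff X (\<psi> {} \<inter> S) \<subseteq> \<sigma> ` {..<d}" unfolding S_def by blast
    then obtain A where A: "A \<subseteq> {..<d}" "sym_diff X (\<psi> {} \<inter> S) = \<sigma> ` A"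
      by (rule subset_imageE)
    have "x = \<psi> A" unfolding \<sigma>[OF A(1)] A(2)[symmetric] X(1) B_def using X(2) by blast
    then show "x \<in> \<psi> ` Pow {..<d}" using A(1) by auto
  qed
  have "H = subcube n S B"
    using subcube_iso(2,3)[where f = f, OF inj \<psi>n range f\<psi> adj] f(2,3) by simp
  with face show ?thesis by (rule that)
qed

section \<open>Containment of subcubes and the colouring problem on faces\<close>

lemma vec_in_subcube_iff:
  assumes "Z \<subseteq> {..<n}" "S \<subseteq> {..<n}" "B \<subseteq> {..<n}"
  shows "vec n Z \<in> pverts (subcube n S B) \<longleftrightarrow> B \<subseteq> Z \<and> Z \<subseteq> B \<union> S"
proof
  assume "vec n Z \<in> pverts (subcube n S B)"
  then obtain X where X: "X \<subseteq> S" "vec n Z = vec n (B \<union> X)"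
    unfolding pverts_subcube by blast
  then have "Z = B \<union> X" using assms vec_eq_iff[of Z n "B \<union> X"] by blast
  then show "B \<subseteq> Z \<and> Z \<subseteq> B \<union> S" using X(1) by blast
next
  assume "B \<subseteq> Z \<and> Z \<subseteq> B \<union> S"
  then have "Z = B \<union> (Z \<inter> S)" by blast
  then show "vec n Z \<in> pverts (subcube n S B)"
    unfolding pverts_subcube by (intro image_eqI[of _ _ "Z \<inter> S"]) auto
qed

lemma subgraph_subcube_iff:
  assumes "is_face i n T C" "is_face d n S B"
  shows "subgraph (with_proj (subcube n T C)) (with_proj (subcube n S B)) \<longleftrightarrow>
    T \<subseteq> S \<and> B \<subseteq> C \<and> C \<subseteq> B \<union> S"
proof -
  have n: "T \<subseteq> {..<n}" "C \<subseteq> {..<n}" "S \<subseteq> {..<n}" "B \<subseteq> {..<n}"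
    and disj: "C \<inter> T = {}" "B \<inter> S = {}"
    using assms by (auto simp: is_face_def)
  have "vec n (C \<union> X) \<in> pverts (subcube n S B) \<longleftrightarrow> B \<subseteq> C \<union> X \<and> C \<union> X \<subseteq> B \<union> S"
    if "X \<subseteq> T" for X
    using n that by (intro vec_in_subcube_iff) auto
  then have "pverts (subcube n T C) \<subseteq> pverts (subcube n S B) \<longleftrightarrow>
    (\<forall>X\<in>Pow T. B \<subseteq> C \<union> X \<and> C \<union> X \<subseteq> B \<union> S)"
    unfolding pverts_subcube[of n T C] by (simp add: image_subset_iff)
  also have "\<dots> \<longleftrightarrow> T \<subseteq> S \<and> B \<subseteq> C \<and> C \<subseteq> B \<union> S" (is "?L \<longleftrightarrow> ?R")
  proof
    assume L: ?L
    \<comment> \<open>The lowest and the highest vertex of the smaller subcube suffice. As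
      \<open>B\<close> lies in \<open>C\<close>, which is disjoint from \<open>T\<close>, the bound
      on \<open>T\<close> sharpens to \<open>S\<close>.\<close>
    have "B \<subseteq> C \<and> C \<subseteq> B \<union> S" "T \<subseteq> B \<union> S"
      using bspec[OF L, of "{}"] bspec[OF L, of T] by simp_all
    then show ?R using disj by blast
  next
    assume ?R
    then show ?L by (intro ballI) blast
  qed
  finally show ?thesis
    using wf_subcube by (auto simp: subgraph_def compatible_def parcs_subcube)
qed

lemma subcube_eq_iff:
  assumes "is_face d n T C" "is_face d n S B"
  shows "subcube n T C = subcube n S B \<longleftrightarrow> T = S \<and> C = B"
proof
  have refl: "subgraph (with_proj (subcube n S B)) (with_proj (subcube n S B))" for S B
    using wf_subcube by (auto simp: subgraph_def compatible_def)
  assume eq: "subcube n T C = subcube n S B"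
  then have "T \<subseteq> S" "B \<subseteq> C" "S \<subseteq> T" "C \<subseteq> B"
    using subgraph_subcube_iff[OF assms] subgraph_subcube_iff[OF assms(2,1)] refl by metis+
  then show "T = S \<and> C = B" by blast
qed simp

text \<open>Removes graphs from the problem: \<open>g\<close> colours pairs of coordinate sets.
  Bounding \<open>C\<close> by \<open>B \<union> (S - T)\<close> keeps it disjoint from
  \<open>T\<close>, so that the pair found is automatically a face.\<close>

lemma ex_polychromatic_colouring_iff:
  "(\<exists>c. polychromatic_colouring i d n r c) \<longleftrightarrow>
    (\<exists>g. (\<forall>T C. is_face i n T C \<longrightarrow> g T C < r) \<and>
      (\<forall>S B. is_face d n S B \<longrightarrow>
        (\<forall>k<r. \<exists>T C. T \<subseteq> S \<and> card T = i \<and> B \<subseteq> C \<and> C \<subseteq> B \<union> (S - T) \<and> g T C = k)))"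
proof -
  have face: "T \<subseteq> S \<and> card T = i \<and> B \<subseteq> C \<and> C \<subseteq> B \<union> (S - T) \<longleftrightarrow>
      is_face i n T C \<and> subgraph (with_proj (subcube n T C)) (with_proj (subcube n S B))"
    if "is_face d n S B" for S T B C
    using that subgraph_subcube_iff[OF _ that, of i T C]
    unfolding is_face_def by blast
  show ?thesis (is "(\<exists>c. ?P c) \<longleftrightarrow> (\<exists>g. ?Q g)")
  proof
    assume "\<exists>c. ?P c"
    then obtain c where c: "?P c" ..
    have "?Q (\<lambda>T C. c (subcube n T C))"
    proof (intro conjI allI impI)
      fix T C assume "is_face i n T C"
      then show "c (subcube n T C) < r"
        using c subcube_in_cube_embeddings[of i n T C]
        unfolding polychromatic_colouring_def by simp
    next
      fix S B k assume S: "is_face d n S B" and "k < r"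
      then obtain K where K: "K \<in> cube_embeddings i n" "c K = k"
        "subgraph (with_proj K) (with_proj (subcube n S B))"
        using c subcube_in_cube_embeddings[OF S] unfolding polychromatic_colouring_def by metis
      obtain T C where "is_face i n T C" "K = subcube n T C"
        using K(1) by (rule cube_embedding_is_subcube)
      then show "\<exists>T C. T \<subseteq> S \<and> card T = i \<and> B \<subseteq> C \<and> C \<subseteq> B \<union> (S - T) \<and> c (subcube n T C) = k"
        using face[OF S, of T C] K(2,3) by (intro exI[of _ T] exI[of _ C]) simp
    qed
    then show "\<exists>g. ?Q g" by (rule exI[of ?Q "\<lambda>T C. c (subcube n T C)"])
  next
    assume "\<exists>g. ?Q g"
    then obtain g where g: "?Q g" ..
    \<comment> \<open>Well defined on embeddings because a subcube determines its free and its fixed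
      coordinates.\<close>
    define c where "c K = (THE k. \<exists>T C. is_face i n T C \<and> K = subcube n T C \<and> k = g T C)" for K
    have c: "c (subcube n T C) = g T C" if "is_face i n T C" for T C
      unfolding c_def using that by (intro the_equality) (auto simp: subcube_eq_iff)
    have "?P c"
      unfolding polychromatic_colouring_def
    proof (intro conjI ballI allI impI)
      fix K assume "K \<in> cube_embeddings i n"
      then obtain T C where "is_face i n T C" "K = subcube n T C"
        by (rule cube_embedding_is_subcube)
      then show "c K < r" using g c by simp
    next
      fix H k assume "H \<in> cube_embeddings d n" "k < r"
      then obtain S B where S: "is_face d n S B" and H: "H = subcube n S B"
        by (elim cube_embedding_is_subcube)
      obtain T C where TC: "T \<subseteq> S \<and> card T = i \<and> B \<subseteq> C \<and> C \<subseteq> B \<union> (S - T)" "g T C = k"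
        using g S \<open>k < r\<close> by metis
      then have T: "is_face i n T C" "subgraph (with_proj (subcube n T C)) (with_proj H)"
        using face[OF S, of T C] H by simp_all
      then show "\<exists>K\<in>cube_embeddings i n. subgraph (with_proj K) (with_proj H) \<and> c K = k"
        using c TC(2) by (intro bexI[of _ "subcube n T C"] subcube_in_cube_embeddings) simp_all
    qed
    then show "\<exists>c. ?P c" by (rule exI[of ?P c])
  qed
qed

section \<open>Colourings determined by gap counts\<close>

text \<open>
  The free coordinates of a 3-cube leave four gaps, containing a, b, c, d ones. Fixing one of them,
  to zero or to one, merges the two gaps next to it.
\<close>

definition gap_faces :: "(nat \<Rightarrow> nat \<Rightarrow> nat \<Rightarrow> 'c) \<Rightarrow> nat \<Rightarrow> nat \<Rightarrow> nat \<Rightarrow> nat \<Rightarrow> 'c set" where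
  "gap_faces F a b c d = {F (a+b) c d, F (Suc (a+b)) c d, F a (b+c) d, F a (Suc (b+c)) d,
    F a b (c+d), F a b (Suc (c+d))}"

text \<open>The six squares arise by fixing one of the three free coordinates at zero or at one. The
  count formula is assumed only for squares of this 3-cube, so the lemma also covers a colouring
  that depends on counts merely within the set supplied by Ramsey's theorem.\<close>

lemma face_colours_eq_gap_faces:
  fixes i j k :: nat
  assumes "i < j" "j < k" "finite B" "B \<inter> {i,j,k} = {}"
    and g: "\<And>x y C. x < y \<Longrightarrow> {x,y} \<subseteq> {i,j,k} \<Longrightarrow> B \<subseteq> C \<Longrightarrow> C \<subseteq> B \<union> ({i,j,k} - {x,y}) \<Longrightarrow>
      g {x,y} C = F (card {z\<in>C. z < x}) (card {z\<in>C. x < z \<and> z < y}) (card {z\<in>C. y < z})"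
  shows "{g T C |T C. T \<subseteq> {i,j,k} \<and> card T = 2 \<and> B \<subseteq> C \<and> C \<subseteq> B \<union> ({i,j,k} - T)} =
    gap_faces F (card {z\<in>B. z < i}) (card {z\<in>B. i < z \<and> z < j})
      (card {z\<in>B. j < z \<and> z < k}) (card {z\<in>B. k < z})" (is "?L = ?R")
proof -
  let ?a = "card {z\<in>B. z < i}" and ?b = "card {z\<in>B. i < z \<and> z < j}"
    and ?c = "card {z\<in>B. j < z \<and> z < k}" and ?d = "card {z\<in>B. k < z}"
  have ijk: "i < k" "i \<noteq> j" "j \<noteq> k" "i \<noteq> k" "i \<notin> B" "j \<notin> B" "k \<notin> B" using assms(1,2,4) by auto
  have pairs: "T \<subseteq> {i,j,k} \<and> card T = 2 \<longleftrightarrow> T = {j,k} \<or> T = {i,k} \<or> T = {i,j}" for T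
  proof
    assume "T \<subseteq> {i,j,k} \<and> card T = 2"
    then obtain x y where "T = {x, y}" "x \<noteq> y" "x \<in> {i,j,k}" "y \<in> {i,j,k}"
      by (auto simp: card_2_iff)
    then show "T = {j,k} \<or> T = {i,k} \<or> T = {i,j}" by auto
  qed (use ijk in auto)
  have between: "{C. B \<subseteq> C \<and> C \<subseteq> B \<union> {x}} = {B, insert x B}" for x by blast
  have diffs: "{i,j,k} - {j,k} = {i}" "{i,j,k} - {i,k} = {j}" "{i,j,k} - {i,j} = {k}"
    using ijk by auto
  have "?L = (\<Union>T\<in>{T. T \<subseteq> {i,j,k} \<and> card T = 2}. g T ` {C. B \<subseteq> C \<and> C \<subseteq> B \<union> ({i,j,k} - T)})"
    by blast
  also have "{T. T \<subseteq> {i,j,k} \<and> card T = 2} = {{j,k},{i,k},{i,j}}"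
    using pairs by (intro set_eqI) (simp only: mem_Collect_eq insert_iff empty_iff simp_thms)
  finally have L: "?L = {g {j,k} B, g {j,k} (insert i B), g {i,k} B, g {i,k} (insert j B),
      g {i,j} B, g {i,j} (insert k B)}"
    by (simp only: UN_insert UN_empty Union_insert Union_empty diffs between image_insert image_empty Un_insert_left Un_empty_left
        Un_empty_right)
  have fin: "finite {z\<in>B. P z}" for P using assms(3) by simp
  have "{z\<in>B. z < j} = {z\<in>B. z < i} \<union> {z\<in>B. i < z \<and> z < j}"
    using ijk assms(1) by (auto; metis linorder_neqE_nat)
  then have ab: "card {z\<in>B. z < j} = ?a + ?b"
    using fin by (simp only:) (subst card_Un_disjoint, auto)
  have "{z\<in>B. i < z \<and> z < k} = {z\<in>B. i < z \<and> z < j} \<union> {z\<in>B. j < z \<and> z < k}"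
    using ijk assms(1,2) by (auto; metis linorder_neqE_nat)
  then have bc: "card {z\<in>B. i < z \<and> z < k} = ?b + ?c"
    using fin by (simp only:) (subst card_Un_disjoint, auto)
  have "{z\<in>B. j < z} = {z\<in>B. j < z \<and> z < k} \<union> {z\<in>B. k < z}"
    using ijk assms(2) by (auto; metis linorder_neqE_nat)
  then have cd: "card {z\<in>B. j < z} = ?c + ?d"
    using fin by (simp only:) (subst card_Un_disjoint, auto)
  have ins: "card {z\<in>insert x B. P z} = (if P x then Suc (card {z\<in>B. P z}) else card {z\<in>B. P z})"
    if "x \<notin> B" for x P
  proof -
    have "{z\<in>insert x B. P z} = (if P x then insert x {z\<in>B. P z} else {z\<in>B. P z})" by auto
    then show ?thesis using that fin by simp
  qed
  have "g {j,k} B = F (?a + ?b) ?c ?d" "g {i,k} B = F ?a (?b + ?c) ?d" "g {i,j} B = F ?a ?b (?c + ?d)"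
    using g[of j k B] g[of i k B] g[of i j B] ijk assms(1,2) ab bc cd by auto
  moreover have "g {j,k} (insert i B) = F (Suc (?a + ?b)) ?c ?d"
  proof -
    have "g {j,k} (insert i B) = F (card {z\<in>insert i B. z < j})
        (card {z\<in>insert i B. j < z \<and> z < k}) (card {z\<in>insert i B. k < z})"
      by (rule g) (use ijk assms(1,2) in auto)
    then show ?thesis
      unfolding ins[OF ijk(5)] ab using ijk assms(1,2) by simp
  qed
  moreover have "g {i,k} (insert j B) = F ?a (Suc (?b + ?c)) ?d"
  proof -
    have "g {i,k} (insert j B) = F (card {z\<in>insert j B. z < i})
        (card {z\<in>insert j B. i < z \<and> z < k}) (card {z\<in>insert j B. k < z})"
      by (rule g) (use ijk assms(1,2) in auto)
    then show ?thesis
      unfolding ins[OF ijk(6)] bc using ijk assms(1,2) by simp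
  qed
  moreover have "g {i,j} (insert k B) = F ?a ?b (Suc (?c + ?d))"
  proof -
    have "g {i,j} (insert k B) = F (card {z\<in>insert k B. z < i})
        (card {z\<in>insert k B. i < z \<and> z < j}) (card {z\<in>insert k B. j < z})"
      by (rule g) (use ijk assms(1,2) in auto)
    then show ?thesis
      unfolding ins[OF ijk(7)] cd using ijk assms(1,2) by simp
  qed
  ultimately show ?thesis unfolding L gap_faces_def by simp
qed

lemma card_3_nat_obtains:
  fixes S :: "nat set"
  assumes "card S = 3"
  obtains i j k where "i < j" "j < k" "S = {i,j,k}"
proof -
  obtain x y z where S: "S = {x,y,z}" "x \<noteq> y" "x \<noteq> z" "y \<noteq> z"
    using assms by (auto simp: card_3_iff)
  consider "x < y \<and> y < z" | "x < z \<and> z < y" | "y < x \<and> x < z" | "y < z \<and> z < x"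
    | "z < x \<and> x < y" | "z < y \<and> y < x" using S by linarith
  then show ?thesis
  proof cases
    case 1 then show ?thesis by (intro that[of x y z]) (auto simp: S(1))
  next
    case 2 then show ?thesis by (intro that[of x z y]) (auto simp: S(1))
  next
    case 3 then show ?thesis by (intro that[of y x z]) (auto simp: S(1))
  next
    case 4 then show ?thesis by (intro that[of y z x]) (auto simp: S(1))
  next
    case 5 then show ?thesis by (intro that[of z x y]) (auto simp: S(1))
  next
    case 6 then show ?thesis by (intro that[of z y x]) (auto simp: S(1))
  qed
qed

section \<open>Three colours\<close>

lemma shifts_mod_3: "k < 3 \<Longrightarrow> k \<in> {w mod 3, (w + 1) mod 3, (w + 2) mod (3::nat)}"
proof -
  assume "k < 3"
  moreover have "w mod 3 = 0 \<or> w mod 3 = 1 \<or> w mod 3 = 2" by linarith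
  moreover have "(w + 1) mod 3 = (w mod 3 + 1) mod 3" "(w + 2) mod 3 = (w mod 3 + 2) mod 3"
    by (simp_all only: mod_add_left_eq)
  ultimately show ?thesis by (elim disjE) auto
qed

text \<open>Here b and c are the inner gaps and m is the total of the outer ones. Fixing the first
  free coordinate gives residues v and v + 2, fixing the last gives v' and v' + 2, and fixing the
  middle one gives two consecutive values if b + c is even and two equal ones otherwise. For b and c
  of equal parity the middle pair supplies the missing v + 1; otherwise v and v' differ, and the two
  outer pairs cover all residues.\<close>

lemma gap_formula_residues:
  fixes k b c m :: nat
  assumes "k < 3"
  shows "k \<in> {((c + 1) div 2 + 2 * (m + b)) mod 3, ((c + 1) div 2 + 2 * (m + b) + 2) mod 3,
    ((b + c + 1) div 2 + 2 * m) mod 3, ((b + c + 2) div 2 + 2 * m) mod 3,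
    ((b + 1) div 2 + 2 * (m + c)) mod 3, ((b + 1) div 2 + 2 * (m + c) + 2) mod 3}"
proof -
  obtain x where x: "c = 2 * x \<or> c = 2 * x + 1" by (metis oddE evenE)
  obtain y where y: "b = 2 * y \<or> b = 2 * y + 1" by (metis oddE evenE)
  \<comment> \<open>Since 4 is 1 modulo 3, every entry becomes \<open>w\<close> plus a constant once
    b and c are halved.\<close>
  define w where "w = x + y + 2 * m"
  have k: "k \<in> {w mod 3, (w + 1) mod 3, (w + 2) mod 3}"
    using assms by (rule shifts_mod_3)
  have shift: "e mod 3 = (w + i) mod 3" if "e = w + i + 3 * q" for e i q
    using that by simp
  consider "c = 2 * x" "b = 2 * y" | "c = 2 * x + 1" "b = 2 * y + 1"
    | "c = 2 * x" "b = 2 * y + 1" | "c = 2 * x + 1" "b = 2 * y"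
    using x y by blast
  then show ?thesis
  proof cases
    case 1
    have e0: "((c + 1) div 2 + 2 * (m + b)) mod 3 = (w + 0) mod 3"
      by (rule shift[where q = "y"]) (simp add: 1 w_def)
    have e1: "((b + c + 2) div 2 + 2 * m) mod 3 = (w + 1) mod 3"
      by (rule shift[where q = "0"]) (simp add: 1 w_def)
    have e2: "((c + 1) div 2 + 2 * (m + b) + 2) mod 3 = (w + 2) mod 3"
      by (rule shift[where q = "y"]) (simp add: 1 w_def)
    show ?thesis using k unfolding e0 e1 e2 by auto
  next
    case 2
    have e0: "((c + 1) div 2 + 2 * (m + b)) mod 3 = (w + 0) mod 3"
      by (rule shift[where q = "(y + 1)"]) (simp add: 2 w_def)
    have e1: "((b + c + 1) div 2 + 2 * m) mod 3 = (w + 1) mod 3"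
      by (rule shift[where q = "0"]) (simp add: 2 w_def)
    have e2: "((c + 1) div 2 + 2 * (m + b) + 2) mod 3 = (w + 2) mod 3"
      by (rule shift[where q = "(y + 1)"]) (simp add: 2 w_def)
    show ?thesis using k unfolding e0 e1 e2 by auto
  next
    case 3
    have e0: "((b + 1) div 2 + 2 * (m + c) + 2) mod 3 = (w + 0) mod 3"
      by (rule shift[where q = "(x + 1)"]) (simp add: 3 w_def)
    have e1: "((b + 1) div 2 + 2 * (m + c)) mod 3 = (w + 1) mod 3"
      by (rule shift[where q = "x"]) (simp add: 3 w_def)
    have e2: "((c + 1) div 2 + 2 * (m + b)) mod 3 = (w + 2) mod 3"
      by (rule shift[where q = "y"]) (simp add: 3 w_def)
    show ?thesis using k unfolding e0 e1 e2 by auto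
  next
    case 4
    have e0: "((c + 1) div 2 + 2 * (m + b) + 2) mod 3 = (w + 0) mod 3"
      by (rule shift[where q = "(y + 1)"]) (simp add: 4 w_def)
    have e1: "((c + 1) div 2 + 2 * (m + b)) mod 3 = (w + 1) mod 3"
      by (rule shift[where q = "y"]) (simp add: 4 w_def)
    have e2: "((b + 1) div 2 + 2 * (m + c)) mod 3 = (w + 2) mod 3"
      by (rule shift[where q = "x"]) (simp add: 4 w_def)
    show ?thesis using k unfolding e0 e1 e2 by auto
  qed
qed

lemma ex_three_colouring: "\<exists>c. polychromatic_colouring 2 3 n 3 c"
proof -
  define F :: "nat \<Rightarrow> nat \<Rightarrow> nat \<Rightarrow> nat" where
    "F a b c = ((b + 1) div 2 + 2 * (a + c)) mod 3" for a b c
  define g where "g T C = F (card {z\<in>C. z < Min T}) (card {z\<in>C. Min T < z \<and> z < Max T})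
    (card {z\<in>C. Max T < z})" for T C :: "nat set"
  have all: "k \<in> gap_faces F a b c d" if "k < 3" for a b c d k
    \<comment> \<open>The outer gaps \<open>a\<close> and \<open>d\<close> enter the formula only
      through their sum.\<close>
    using gap_formula_residues[OF that, of c "a + d" b] unfolding gap_faces_def F_def
    by (simp add: algebra_simps)
  have "\<exists>T C. T \<subseteq> S \<and> card T = 2 \<and> B \<subseteq> C \<and> C \<subseteq> B \<union> (S - T) \<and> g T C = k"
    if "is_face 3 n S B" "k < 3" for S B k
  proof -
    have S: "card S = 3" "B \<inter> S = {}" and "finite B"
      using that(1) finite_subset[of B "{..<n}"] by (auto simp: is_face_def)
    obtain i j l where ijl: "i < j" "j < l" "S = {i,j,l}"
      using card_3_nat_obtains[OF S(1)] .
    have g_eq: "g {x,y} C = F (card {z\<in>C. z < x}) (card {z\<in>C. x < z \<and> z < y}) (card {z\<in>C. y < z})"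
      if "x < y" for x y C
    proof -
      have "Min {x,y} = x" "Max {x,y} = y" using that by auto
      then show ?thesis by (simp only: g_def)
    qed
    have "{g T C |T C. T \<subseteq> {i,j,l} \<and> card T = 2 \<and> B \<subseteq> C \<and> C \<subseteq> B \<union> ({i,j,l} - T)} =
      gap_faces F (card {z\<in>B. z < i}) (card {z\<in>B. i < z \<and> z < j})
        (card {z\<in>B. j < z \<and> z < l}) (card {z\<in>B. l < z})"
      using S(2) unfolding ijl(3)
      by (intro face_colours_eq_gap_faces ijl(1,2) \<open>finite B\<close> g_eq)
    then have "k \<in> {g T C |T C. T \<subseteq> S \<and> card T = 2 \<and> B \<subseteq> C \<and> C \<subseteq> B \<union> (S - T)}"
      using all[OF that(2)] unfolding ijl(3) by simp
    then show ?thesis by blast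
  qed
  moreover have "g T C < 3" for T C by (simp add: g_def F_def)
  ultimately show ?thesis
    unfolding ex_polychromatic_colouring_iff by (intro exI[of _ g] conjI allI impI)
qed

section \<open>Ramsey reduction\<close>

text \<open>Ramsey's theorem is carried from \<open>{..<N}\<close> to arbitrary finite sets along an
  injection, because the iteration in \<open>ramsey_family\<close> works inside sets that have
  already been thinned out.\<close>

lemma ramsey_nat_set:
  "\<exists>N. \<forall>(V :: nat set) h. finite V \<longrightarrow> N \<le> card V \<longrightarrow> (\<forall>X\<in>nsets V u. h X < (r::nat)) \<longrightarrow>
    (\<exists>H\<subseteq>V. card H = m \<and> (\<exists>k. \<forall>X\<in>nsets H u. h X = k))"
proof -
  obtain N :: nat where N: "partn_lst {..<N} (replicate r m) u"
    using ramsey_full by blast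
  have "\<exists>H\<subseteq>V. card H = m \<and> (\<exists>k. \<forall>X\<in>nsets H u. h X = k)"
    if V: "finite V" "N \<le> card V" and h: "\<forall>X\<in>nsets V u. h X < r" for V :: "nat set" and h
  proof -
    obtain e where e: "inj_on e {..<N}" "e ` {..<N} \<subseteq> V"
      using card_le_inj[of "{..<N}" V] V by auto
    have "(\<lambda>X. h (e ` X)) \<in> nsets {..<N} u \<rightarrow> {..<r}"
    proof
      fix X assume "X \<in> nsets {..<N} u"
      then have "e ` X \<in> nsets V u"
        using e by (auto simp: nsets_def card_image inj_on_subset)
      then show "h (e ` X) \<in> {..<r}" using h by simp
    qed
    then obtain i H where H: "i < r" "H \<in> nsets {..<N} (replicate r m ! i)"
      "(\<lambda>X. h (e ` X)) ` nsets H u \<subseteq> {i}"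
      using partn_lstE[OF N, of "\<lambda>X. h (e ` X)" r thesis] by auto
    have HN: "H \<subseteq> {..<N}" "card H = m" using H(1,2) by (auto simp: nsets_def)
    have injH: "inj_on e H" using e(1) HN(1) by (rule inj_on_subset)
    have "h X = i" if X: "X \<in> nsets (e ` H) u" for X
    proof -
      have "X \<subseteq> e ` H" using X by (simp add: nsets_def)
      then obtain Y where Y: "Y \<subseteq> H" "X = e ` Y" by (rule subset_imageE)
      then have "inj_on e Y" using injH inj_on_subset by blast
      then have "Y \<in> nsets H u"
        using X Y by (auto simp: nsets_def card_image finite_image_iff)
      then show ?thesis using H(3) Y(2) by auto
    qed
    moreover have "e ` H \<subseteq> V" using HN e(2) by blast
    moreover have "card (e ` H) = m" using injH HN by (simp add: card_image)
    ultimately show ?thesis by (intro exI[of _ "e ` H"] conjI exI[of _ i] ballI)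
  qed
  then show ?thesis by (intro exI[of _ N] allI impI)
qed

text \<open>Being constant is inherited by subsets: the colouring for \<open>t\<close> is made
  constant on some \<open>W\<close> first, and the selection for the remaining indices inside
  \<open>W\<close> preserves this.\<close>

lemma ramsey_family:
  assumes "finite I"
  shows "\<exists>N. \<forall>(V :: nat set) h. finite V \<longrightarrow> N \<le> card V \<longrightarrow>
    (\<forall>t\<in>I. \<forall>X\<in>nsets V (u t). h t X < (r::nat)) \<longrightarrow>
    (\<exists>H\<subseteq>V. card H = m \<and> (\<forall>t\<in>I. \<exists>k. \<forall>X\<in>nsets H (u t). h t X = k))"
  using assms
proof induction
  case empty
  have "\<exists>H\<subseteq>V. card H = m" if "m \<le> card V" for V :: "nat set"
    using obtain_subset_with_card_n[OF that] by metis
  then show ?case by (intro exI[of _ m]) simp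
next
  case (insert t I)
  from insert.IH obtain N where N: "\<forall>(V :: nat set) h. finite V \<longrightarrow> N \<le> card V \<longrightarrow>
    (\<forall>t\<in>I. \<forall>X\<in>nsets V (u t). h t X < r) \<longrightarrow>
    (\<exists>H\<subseteq>V. card H = m \<and> (\<forall>t\<in>I. \<exists>k. \<forall>X\<in>nsets H (u t). h t X = k))" ..
  \<comment> \<open>The set requested for \<open>t\<close> has size \<open>N\<close>, enough for the
    rest of the family, rather than the final size \<open>m\<close>.\<close>
  from ramsey_nat_set[of "u t" r N] obtain M where M: "\<forall>(V :: nat set) h. finite V \<longrightarrow>
    M \<le> card V \<longrightarrow> (\<forall>X\<in>nsets V (u t). h X < r) \<longrightarrow>
    (\<exists>H\<subseteq>V. card H = N \<and> (\<exists>k. \<forall>X\<in>nsets H (u t). h X = k))" ..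
  have "\<exists>H\<subseteq>V. card H = m \<and> (\<forall>s\<in>insert t I. \<exists>k. \<forall>X\<in>nsets H (u s). h s X = k)"
    if V: "finite V" "M \<le> card V" and h: "\<forall>s\<in>insert t I. \<forall>X\<in>nsets V (u s). h s X < r"
    for V :: "nat set" and h
  proof -
    obtain W k where W: "W \<subseteq> V" "card W = N" "\<forall>X\<in>nsets W (u t). h t X = k"
      using M[THEN spec, THEN spec, of V "h t", THEN mp, OF V(1), THEN mp, OF V(2)] h by auto
    have hW: "\<forall>s\<in>I. \<forall>X\<in>nsets W (u s). h s X < r"
      using h nsets_mono[OF W(1)] by (meson insertCI subsetD)
    have "finite W" using V(1) W(1) finite_subset by blast
    then obtain H where H: "H \<subseteq> W" "card H = m" "\<forall>s\<in>I. \<exists>k. \<forall>X\<in>nsets H (u s). h s X = k"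
      using N[THEN spec, THEN spec, of W h] W(2) hW by auto
    moreover have "\<forall>X\<in>nsets H (u t). h t X = k"
      using W(3) nsets_mono[OF H(1)] by blast
    ultimately show ?thesis using W(1) by (intro exI[of _ H] conjI) auto
  qed
  then show ?case by (intro exI[of _ M] allI impI)
qed

section \<open>No four colours\<close>

text \<open>
  Recovers the free coordinates of a square from the union X of its free coordinates and its ones.
\<close>

definition stars :: "nat \<Rightarrow> nat \<Rightarrow> nat set \<Rightarrow> nat set" where
  "stars a b X = {z\<in>X. card {w\<in>X. w < z} \<in> {a, Suc (a + b)}}"

lemma rank_less:
  fixes X :: "'a::linorder set"
  assumes "finite X" "z \<in> X" "z < z'"
  shows "card {w\<in>X. w < z} < card {w\<in>X. w < z'}"
  using assms by (intro psubset_card_mono) auto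

lemma rank_eq_iff:
  fixes X :: "'a::linorder set"
  assumes "finite X" "z \<in> X" "z' \<in> X"
  shows "card {w\<in>X. w < z} = card {w\<in>X. w < z'} \<longleftrightarrow> z = z'"
  using rank_less[OF assms(1,2), of z'] rank_less[OF assms(1,3), of z]
  by (cases z z' rule: linorder_cases) auto

text \<open>In increasing order \<open>x\<close> is preceded by the ones before it, and
  \<open>y\<close> by those, by the ones in between and by \<open>x\<close> itself, which is the
  \<open>Suc\<close> in \<open>stars\<close>. Ranks are injective, so no other element is
  picked.\<close>

lemma stars_insert2:
  assumes "x < y" "finite C" "x \<notin> C" "y \<notin> C"
  shows "stars (card {z\<in>C. z < x}) (card {z\<in>C. x < z \<and> z < y}) (insert x (insert y C)) = {x, y}"
proof -
  let ?X = "insert x (insert y C)"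
  let ?rank = "\<lambda>z. card {w\<in>?X. w < z}"
  have "{w\<in>?X. w < x} = {z\<in>C. z < x}" using assms(1) by auto
  then have x: "?rank x = card {z\<in>C. z < x}" by simp
  have "{w\<in>?X. w < y} = insert x ({z\<in>C. z < x} \<union> {z\<in>C. x < z \<and> z < y})"
    using assms(1,3) by (auto; metis linorder_neqE_nat)
  also have "card \<dots> = Suc (card {z\<in>C. z < x} + card {z\<in>C. x < z \<and> z < y})"
    using assms(2,3) by (subst card_insert_disjoint, simp, simp) (subst card_Un_disjoint, auto)
  finally have y: "?rank y = Suc (card {z\<in>C. z < x} + card {z\<in>C. x < z \<and> z < y})" .
  have "stars (card {z\<in>C. z < x}) (card {z\<in>C. x < z \<and> z < y}) ?X =
    {z\<in>?X. ?rank z = ?rank x \<or> ?rank z = ?rank y}"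
    unfolding stars_def unfolding y[symmetric] unfolding x[symmetric]
    by (simp only: insert_iff empty_iff simp_thms)
  also have "\<dots> = {z\<in>?X. z = x \<or> z = y}"
    using assms(2) by (intro Collect_cong conj_cong refl disj_cong rank_eq_iff) simp_all
  also have "\<dots> = {x, y}" by auto
  finally show ?thesis .
qed

text \<open>Counts up to \<open>m\<close> suffice, since the ones of a square inside
  \<open>H\<close> form a subset of a set of size \<open>m\<close>. The constant obtained for each
  triple of counts is the value of \<open>F\<close> there.\<close>

lemma simple_colouring_on_subset:
  "\<exists>N. \<forall>n\<ge>N. \<forall>g. (\<forall>T C. is_face 2 n T C \<longrightarrow> g T C < (r::nat)) \<longrightarrow>
    (\<exists>H\<subseteq>{..<n}. card H = m \<and> (\<exists>F. \<forall>x y C. x < y \<longrightarrow> {x,y} \<subseteq> H \<longrightarrow> C \<subseteq> H - {x,y} \<longrightarrow>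
      g {x,y} C = F (card {z\<in>C. z < x}) (card {z\<in>C. x < z \<and> z < y}) (card {z\<in>C. y < z})))"
proof -
  define I where "I = {..m} \<times> {..m} \<times> {..m}"
  define u where "u t = (case t of (a, b, c) \<Rightarrow> a + b + c + 2)" for t :: "nat \<times> nat \<times> nat"
  have "finite I" by (simp add: I_def)
  from ramsey_family[OF this, of u r m] obtain N where N: "\<forall>(V :: nat set) h. finite V \<longrightarrow> N \<le> card V \<longrightarrow>
    (\<forall>t\<in>I. \<forall>X\<in>nsets V (u t). h t X < r) \<longrightarrow>
    (\<exists>H\<subseteq>V. card H = m \<and> (\<forall>t\<in>I. \<exists>k. \<forall>X\<in>nsets H (u t). h t X = k))" ..
  have "\<exists>H\<subseteq>{..<n}. card H = m \<and> (\<exists>F. \<forall>x y C. x < y \<longrightarrow> {x,y} \<subseteq> H \<longrightarrow> C \<subseteq> H - {x,y} \<longrightarrow>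
      g {x,y} C = F (card {z\<in>C. z < x}) (card {z\<in>C. x < z \<and> z < y}) (card {z\<in>C. y < z}))"
    if n: "max N 2 \<le> n" and g: "\<forall>T C. is_face 2 n T C \<longrightarrow> g T C < r" for n g
  proof -
    \<comment> \<open>The lower bound 2 on n provides a square, and its colour forces
      \<open>r\<close> to be positive.\<close>
    have "is_face 2 n {0,1} {}" using n by (simp add: is_face_def)
    then have "0 < r" using g by (metis gr_implies_not_zero neq0_conv)
    \<comment> \<open>Reducing modulo r bounds h without having to show that \<open>stars a b X\<close> has two elements.\<close>
    define h where "h t X = (case t of (a, b, c) \<Rightarrow> g (stars a b X) (X - stars a b X) mod r)"
      for t :: "nat \<times> nat \<times> nat" and X
    have "\<forall>t\<in>I. \<forall>X\<in>nsets {..<n} (u t). h t X < r"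
      using \<open>0 < r\<close> by (simp add: h_def split: prod.split)
    then obtain H where H: "H \<subseteq> {..<n}" "card H = m" "\<forall>t\<in>I. \<exists>k. \<forall>X\<in>nsets H (u t). h t X = k"
      using N[THEN spec, THEN spec, of "{..<n}" h] n by auto
    from bchoice[OF H(3)] obtain f where f: "\<forall>t\<in>I. \<forall>X\<in>nsets H (u t). h t X = f t" ..
    have "finite H" using H(1) finite_subset by blast
    have "g {x,y} C = f (card {z\<in>C. z < x}, card {z\<in>C. x < z \<and> z < y}, card {z\<in>C. y < z})"
      if xy: "x < y" "{x,y} \<subseteq> H" "C \<subseteq> H - {x,y}" for x y C
    proof -
      let ?a = "card {z\<in>C. z < x}" and ?b = "card {z\<in>C. x < z \<and> z < y}" and ?c = "card {z\<in>C. y < z}"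
      let ?X = "insert x (insert y C)"
      have C: "finite C" "x \<notin> C" "y \<notin> C" "C \<subseteq> H"
        using xy(3) \<open>finite H\<close> finite_subset[of C H] by auto
      have le: "card {z\<in>C. P z} \<le> m" for P
        using card_mono[of H "{z\<in>C. P z}"] C(4) \<open>finite H\<close> H(2) by auto
      have "C = {z\<in>C. z < x} \<union> ({z\<in>C. x < z \<and> z < y} \<union> {z\<in>C. y < z})"
        using C xy(1) by (auto; metis linorder_neqE_nat)
      then have "card C = card ({z\<in>C. z < x} \<union> ({z\<in>C. x < z \<and> z < y} \<union> {z\<in>C. y < z}))" by simp
      also have "\<dots> = ?a + card ({z\<in>C. x < z \<and> z < y} \<union> {z\<in>C. y < z})"
        using C(1) xy(1) by (intro card_Un_disjoint) auto
      also have "card ({z\<in>C. x < z \<and> z < y} \<union> {z\<in>C. y < z}) = ?b + ?c"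
        using C(1) by (intro card_Un_disjoint) auto
      finally have cardC: "card C = ?a + ?b + ?c" by simp
      then have "card ?X = u (?a, ?b, ?c)" using C xy(1) by (simp add: u_def)
      then have X: "?X \<in> nsets H (u (?a, ?b, ?c))"
        using xy(2) C by (simp add: nsets_def)
      have stars: "stars ?a ?b ?X = {x,y}" using xy(1) C(1-3) by (rule stars_insert2)
      have diff: "?X - {x,y} = C" using C by auto
      have face: "is_face 2 n {x,y} C" using xy H(1) C by (auto simp: is_face_def)
      have "(?a, ?b, ?c) \<in> I" using le by (simp add: I_def)
      then have "h (?a, ?b, ?c) ?X = f (?a, ?b, ?c)" using f X by blast
      then have "g {x,y} C mod r = f (?a, ?b, ?c)" by (simp only: h_def prod.case stars diff)
      then show ?thesis using g face by simp
    qed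
    then show ?thesis using H(1,2)
      by (intro exI[of _ H] conjI exI[of _ "\<lambda>a b c. f (a, b, c)"] allI impI)
  qed
  then show ?thesis by (intro exI[of _ "max N 2"] allI impI)
qed

text \<open>
  In the next two lemmas z, p, q, r, s, t stand for the colours F 0 0 0, F 1 0 0, F 0 1 0, F 0 0 1,
  F 1 0 1, F 1 1 0, then e, g, h, u for F 0 1 1, F 0 0 2, F 2 0 0, F 0 2 0, and v102 for F 1 0 2 etc.
\<close>

lemma four_colours_start:
  assumes "distinct [z,p,q,r]"
    "{z,p,q,r} \<subseteq> {r,s,e,g}" "{z,p,q,r} \<subseteq> {p,h,t,s}"
    "{z,p,q,r} \<subseteq> {q,t,u,r,g}" "{z,p,q,r} \<subseteq> {p,h,q,u,e}"
  shows "g = p \<and> h = r \<and> e = t \<and> {z,p,q,r} = {p,r,s,t}"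
proof -
  \<comment> \<open>Each of these lines drops colours that the right-hand set already shows. In the
    first two, three colours then fill three places, so \<open>s\<close> lies in both
    \<open>{z,p,q}\<close> and \<open>{z,q,r}\<close>.\<close>
  have s1: "{z,p,q} \<subseteq> {s,e,g}" using assms(1,2) by simp
  have s2: "{z,q,r} \<subseteq> {h,t,s}" using assms(1,3) by auto
  have s3: "{z,p} \<subseteq> {t,u,g}" using assms(1,4) by simp
  have s4: "{z,r} \<subseteq> {h,u,e}" using assms(1,5) by auto
  have "s = z \<or> s = q" using assms(1) s1 s2 by auto
  \<comment> \<open>The two remaining solutions differ by exchanging \<open>z\<close> and
    \<open>q\<close>; the conclusion is phrased through \<open>s\<close> and \<open>t\<close> to
    cover both.\<close>
  then have "g = p \<and> h = r \<and> e = t \<and> (s = z \<and> t = q \<or> s = q \<and> t = z)"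
    using assms(1) s1 s2 s3 s4 by auto
  then show ?thesis by auto
qed

text \<open>The \<open>R\<close> assumptions belong to 3-cubes with empty inner gaps, the digits
  being the outer gaps: three of the six squares share their counts, so the four values must be four
  different colours. Reversing the order of coordinates turns \<open>F a b c\<close> into
  \<open>F c b a\<close>, exchanges p and r and fixes s and t; it preserves the first of the three
  cases and swaps the other two.\<close>

lemma four_colours_contradiction:
  assumes d: "distinct [p,r,s,t]"
   and R02: "{p,r,s,t} \<subseteq> {p,v102,v012,v003}"
   and R11: "{p,r,s,t} \<subseteq> {s,v201,v111,v102}"
   and R20: "{p,r,s,t} \<subseteq> {r,v300,v210,v201}"
   and Q1: "{p,r,s,t} \<subseteq> {u,v120,v030,p,v003}"
   and Q2: "{p,r,s,t} \<subseteq> {r,v300,u,v030,v021}"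
   and Q3: "{p,r,s,t} \<subseteq> {t,v111,v021,p,v003}"
   and Q4: "{p,r,s,t} \<subseteq> {r,v300,t,v120,v111}"
   and Q5: "{p,r,s,t} \<subseteq> {s,v201,t,v021,v012}"
   and Q6: "{p,r,s,t} \<subseteq> {t,v210,v120,s,v102}"
  shows False
proof -
  \<comment> \<open>\<open>R11\<close> makes \<open>v201\<close>, \<open>v111\<close>,
    \<open>v102\<close> a permutation of p, r, t, while \<open>R02\<close> forbids
    \<open>v102 = p\<close> and \<open>R20\<close> forbids \<open>v201 = r\<close>.\<close>
  have "v102 = r \<and> v201 = p \<and> v111 = t \<or> v102 = r \<and> v201 = t \<and> v111 = p \<or>
      v102 = t \<and> v201 = p \<and> v111 = r"
    using d R02 R11 R20 by auto
  then consider "v102 = r" "v201 = p" "v111 = t" | "v102 = r" "v201 = t" "v111 = p"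
    | "v102 = t" "v201 = p" "v111 = r"
    by blast
  then show False
  proof cases
    case 1
    have "v003 = s" "v021 = r" using 1 d R02 Q3 by auto
    moreover have "v300 = s" "v120 = p" using 1 d R20 Q4 by auto
    \<comment> \<open>\<open>u\<close> and \<open>v030\<close> would have to be r and t by
      \<open>Q1\<close>, but p and t by \<open>Q2\<close>.\<close>
    ultimately show False using d Q1 Q2 by auto
  next
    case 2
    have "v003 = s" "v021 = r" using 2 d R02 Q3 by auto
    then show False using 2 d R02 Q5 by auto
  next
    case 3
    have "v300 = s" "v120 = p" using 3 d R20 Q4 by auto
    then show False using 3 d R20 Q6 by auto
  qed
qed

lemma not_four_gap_faces:
  fixes F :: "nat \<Rightarrow> nat \<Rightarrow> nat \<Rightarrow> nat"
  assumes F: "\<And>a b c d. a + b + c + d \<le> 2 \<Longrightarrow> {..<4} \<subseteq> gap_faces F a b c d"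
  shows False
proof -
  have *: "{0,1,2,3} \<subseteq> {F (a+b) c d, F (Suc (a+b)) c d, F a (b+c) d, F a (Suc (b+c)) d,
      F a b (c+d), F a b (Suc (c+d))}"
    if "a + b + c + d \<le> 2" for a b c d
  proof -
    have "{..<4} = {0,1,2,3::nat}" by auto
    then show ?thesis using F[OF that] by (simp only: gap_faces_def)
  qed
  let ?z = "F 0 0 0" and ?p = "F 1 0 0" and ?q = "F 0 1 0" and ?r = "F 0 0 1"
  let ?s = "F 1 0 1" and ?t = "F 1 1 0"
  \<comment> \<open>The squares of the 3-cube without ones have only four count vectors, so their
    values are exactly the four colours. Stating the later inclusions through these values avoids
    deciding which colour is which.\<close>
  have sub: "{0,1,2,3} \<subseteq> {?z,?p,?q,?r}"
    using *[of 0 0 0 0] by (simp add: insert_commute)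
  have "card {0,1,2,3::nat} = 4" by simp
  then have "card {?z,?p,?q,?r} \<ge> 4"
    using card_mono[OF _ sub] by simp
  then have d: "distinct [?z,?p,?q,?r]"
    by (auto simp: card_insert_if split: if_splits)
  have C: "{0,1,2,3} = {?z,?p,?q,?r}"
    using sub d by (intro card_subset_eq) auto
  note nums = numeral_2_eq_2 numeral_3_eq_3
  have a1: "{?z,?p,?q,?r} \<subseteq> {?r, ?s, F 0 1 1, F 0 0 2}"
    unfolding C[symmetric]
    by (rule subset_trans[OF *[of 0 0 0 1]]) (simp_all add: nums)
  have a2: "{?z,?p,?q,?r} \<subseteq> {?p, F 2 0 0, ?t, ?s}"
    unfolding C[symmetric]
    by (rule subset_trans[OF *[of 1 0 0 0]]) (simp_all add: nums)
  have a3: "{?z,?p,?q,?r} \<subseteq> {?q, ?t, F 0 2 0, ?r, F 0 0 2}"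
    unfolding C[symmetric]
    by (rule subset_trans[OF *[of 0 0 1 0]]) (simp_all add: nums)
  have a4: "{?z,?p,?q,?r} \<subseteq> {?p, F 2 0 0, ?q, F 0 2 0, F 0 1 1}"
    unfolding C[symmetric]
    by (rule subset_trans[OF *[of 0 1 0 0]]) (simp_all add: nums)
  from four_colours_start[OF d a1 a2 a3 a4]
  have A: "F 0 0 2 = ?p" "F 2 0 0 = ?r" "F 0 1 1 = ?t" "{?z,?p,?q,?r} = {?p,?r,?s,?t}"
    by blast+
  note A' = A(1-3)[unfolded numeral_2_eq_2 One_nat_def]
  have "card {?p,?r,?s,?t} = 4"
    using C A(4) \<open>card {0,1,2,3::nat} = 4\<close> by simp
  then have d': "distinct [?p,?r,?s,?t]"
    by (auto simp: card_insert_if split: if_splits)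
  have C': "{0,1,2,3} = {?p,?r,?s,?t}" using C A(4) by simp
  have b1: "{?p,?r,?s,?t} \<subseteq> {?p, F 1 0 2, F 0 1 2, F 0 0 3}"
    unfolding C'[symmetric]
    by (rule subset_trans[OF *[of 0 0 0 2]]) (simp_all add: A' nums)
  have b2: "{?p,?r,?s,?t} \<subseteq> {?s, F 2 0 1, F 1 1 1, F 1 0 2}"
    unfolding C'[symmetric]
    by (rule subset_trans[OF *[of 1 0 0 1]]) (simp_all add: A' nums)
  have b3: "{?p,?r,?s,?t} \<subseteq> {?r, F 3 0 0, F 2 1 0, F 2 0 1}"
    unfolding C'[symmetric]
    by (rule subset_trans[OF *[of 2 0 0 0]]) (simp_all add: A' nums)
  have b4: "{?p,?r,?s,?t} \<subseteq> {F 0 2 0, F 1 2 0, F 0 3 0, ?p, F 0 0 3}"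
    unfolding C'[symmetric]
    by (rule subset_trans[OF *[of 0 0 2 0]]) (simp_all add: A' nums)
  have b5: "{?p,?r,?s,?t} \<subseteq> {?r, F 3 0 0, F 0 2 0, F 0 3 0, F 0 2 1}"
    unfolding C'[symmetric]
    by (rule subset_trans[OF *[of 0 2 0 0]]) (simp_all add: A' nums)
  have b6: "{?p,?r,?s,?t} \<subseteq> {?t, F 1 1 1, F 0 2 1, ?p, F 0 0 3}"
    unfolding C'[symmetric]
    by (rule subset_trans[OF *[of 0 0 1 1]]) (simp_all add: A' nums)
  have b7: "{?p,?r,?s,?t} \<subseteq> {?r, F 3 0 0, ?t, F 1 2 0, F 1 1 1}"
    unfolding C'[symmetric]
    by (rule subset_trans[OF *[of 1 1 0 0]]) (simp_all add: A' nums)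
  have b8: "{?p,?r,?s,?t} \<subseteq> {?s, F 2 0 1, ?t, F 0 2 1, F 0 1 2}"
    unfolding C'[symmetric]
    by (rule subset_trans[OF *[of 0 1 0 1]]) (simp_all add: A' nums)
  have b9: "{?p,?r,?s,?t} \<subseteq> {?t, F 2 1 0, F 1 2 0, ?s, F 1 0 2}"
    unfolding C'[symmetric]
    by (rule subset_trans[OF *[of 1 0 1 0]]) (simp_all add: A' nums)
  show False
    by (rule four_colours_contradiction[OF d' b1 b2 b3 b4 b5 b6 b7 b8 b9])
qed

text \<open>List the first a + b + c + d + 3 elements of \<open>H\<close> in increasing order,
  counting from zero: those at positions a, a + b + 1 and a + b + c + 2 become free, all others
  become ones.\<close>

lemma cube_with_gaps:
  fixes H :: "nat set"
  assumes "finite H" "a + b + c + d + 3 \<le> card H"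
  obtains i j k B where "i < j" "j < k" "{i,j,k} \<subseteq> H" "B \<subseteq> H - {i,j,k}"
    "card {z\<in>B. z < i} = a" "card {z\<in>B. i < z \<and> z < j} = b"
    "card {z\<in>B. j < z \<and> z < k} = c" "card {z\<in>B. k < z} = d"
proof -
  define e where "e p = sorted_list_of_set H ! p" for p
  let ?n = "a + b + c + d + 3"
  have mono: "e p < e q" if "p < q" "q < ?n" for p q
    unfolding e_def using that assms
    by (intro sorted_wrt_nth_less[of "(<)" "sorted_list_of_set H"]) auto
  have lt: "e p < e q \<longleftrightarrow> p < q" if "p < ?n" "q < ?n" for p q
    using mono[of p q] mono[of q p] that by (cases p q rule: linorder_cases) auto
  have inj: "inj_on e {..<?n}"
  proof (rule inj_onI)
    fix p q assume "p \<in> {..<?n}" "q \<in> {..<?n}" "e p = e q"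
    then show "p = q" using lt[of p q] lt[of q p] by auto
  qed
  have mem: "e p \<in> H" if "p < ?n" for p
    using that assms nth_mem[of p "sorted_list_of_set H"] by (simp add: e_def)
  let ?i = a and ?j = "Suc (a + b)" and ?k = "Suc (Suc (a + b + c))"
  define D where "D = {..<?n} - {?i,?j,?k}"
  have card_eq: "card {z \<in> e ` D. P z} = card W"
    if "\<And>p. p < ?n \<Longrightarrow> p \<in> D \<and> P (e p) \<longleftrightarrow> p \<in> W" "W \<subseteq> {..<?n}" for P W
  proof -
    have "{z \<in> e ` D. P z} = e ` W"
      using that by (auto simp: D_def)
    then show ?thesis using card_image[OF inj_on_subset[OF inj that(2)]] by simp
  qed
  have c1: "card {z\<in>e ` D. z < e ?i} = card {..<a}"
    by (rule card_eq) (auto simp: D_def lt)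
  have c2: "card {z\<in>e ` D. e ?i < z \<and> z < e ?j} = card {Suc a..<Suc (a + b)}"
    by (rule card_eq) (auto simp: D_def lt)
  have c3: "card {z\<in>e ` D. e ?j < z \<and> z < e ?k} = card {Suc (Suc (a + b))..<Suc (Suc (a + b + c))}"
    by (rule card_eq) (auto simp: D_def lt)
  have c4: "card {z\<in>e ` D. e ?k < z} = card {Suc (Suc (Suc (a + b + c)))..<?n}"
    by (rule card_eq) (auto simp: D_def lt)
  have "e ` D \<subseteq> H - {e ?i, e ?j, e ?k}"
  proof
    fix z assume "z \<in> e ` D"
    then obtain p where p: "z = e p" "p < ?n" "p \<noteq> ?i" "p \<noteq> ?j" "p \<noteq> ?k"
      by (auto simp: D_def)
    then show "z \<in> H - {e ?i, e ?j, e ?k}"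
      using mem[of p] inj_onD[OF inj, of p ?i] inj_onD[OF inj, of p ?j] inj_onD[OF inj, of p ?k]
      by auto
  qed
  show ?thesis
  proof (rule that)
    show "e ` D \<subseteq> H - {e ?i, e ?j, e ?k}" by fact
    show "e ?i < e ?j" "e ?j < e ?k" by (simp_all add: lt)
    show "{e ?i, e ?j, e ?k} \<subseteq> H" using mem by simp
  qed (use c1 c2 c3 c4 in simp_all)
qed

lemma colours_le_three:
  assumes "\<forall>n\<ge>3. \<exists>c. polychromatic_colouring 2 3 n r c"
  shows "r \<le> 3"
proof (rule ccontr)
  assume "\<not> r \<le> 3"
  obtain N where N: "\<forall>n\<ge>N. \<forall>g. (\<forall>T C. is_face 2 n T C \<longrightarrow> g T C < r) \<longrightarrow>
    (\<exists>H\<subseteq>{..<n}. card H = 5 \<and> (\<exists>F. \<forall>x y C. x < y \<longrightarrow> {x,y} \<subseteq> H \<longrightarrow> C \<subseteq> H - {x,y} \<longrightarrow>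
      g {x,y} C = F (card {z\<in>C. z < x}) (card {z\<in>C. x < z \<and> z < y}) (card {z\<in>C. y < z})))"
    using simple_colouring_on_subset[of r 5] ..
  define n where "n = max N 3"
  have n: "N \<le> n" "3 \<le> n" by (simp_all add: n_def)
  then have "\<exists>c. polychromatic_colouring 2 3 n r c" using assms by blast
  then obtain g where g: "\<forall>T C. is_face 2 n T C \<longrightarrow> g T C < r"
    and poly: "\<forall>S B. is_face 3 n S B \<longrightarrow> (\<forall>k<r. \<exists>T C. T \<subseteq> S \<and> card T = 2 \<and> B \<subseteq> C \<and>
      C \<subseteq> B \<union> (S - T) \<and> g T C = k)"
    unfolding ex_polychromatic_colouring_iff by (elim exE conjE)
  obtain H F where H: "H \<subseteq> {..<n}" "card H = 5"
    and F: "\<forall>x y C. x < y \<longrightarrow> {x,y} \<subseteq> H \<longrightarrow> C \<subseteq> H - {x,y} \<longrightarrow>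
      g {x,y} C = F (card {z\<in>C. z < x}) (card {z\<in>C. x < z \<and> z < y}) (card {z\<in>C. y < z})"
    using N[THEN spec, THEN mp, OF n(1), THEN spec, THEN mp, OF g] by (elim exE conjE)
  have "finite H" using H(1) finite_subset by blast
  \<comment> \<open>Here \<open>r\<close> may exceed four; only the presence of the colours 0 to 3
    is tracked, and \<open>F\<close> may take further values.\<close>
  have "{..<4} \<subseteq> gap_faces F a b c d" if "a + b + c + d \<le> 2" for a b c d
  proof -
    have "a + b + c + d + 3 \<le> card H" using that H(2) by simp
    from cube_with_gaps[OF \<open>finite H\<close> this] obtain i j k B
      where ijk: "i < j" "j < k" "{i,j,k} \<subseteq> H" and B: "B \<subseteq> H - {i,j,k}"
        and gaps: "card {z\<in>B. z < i} = a" "card {z\<in>B. i < z \<and> z < j} = b"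
          "card {z\<in>B. j < z \<and> z < k} = c" "card {z\<in>B. k < z} = d" .
    have "finite B" using B \<open>finite H\<close> finite_subset by blast
    have face: "is_face 3 n {i,j,k} B"
      using ijk B H(1) by (auto simp: is_face_def)
    have "{g T C |T C. T \<subseteq> {i,j,k} \<and> card T = 2 \<and> B \<subseteq> C \<and> C \<subseteq> B \<union> ({i,j,k} - T)} =
      gap_faces F (card {z\<in>B. z < i}) (card {z\<in>B. i < z \<and> z < j})
        (card {z\<in>B. j < z \<and> z < k}) (card {z\<in>B. k < z})"
    proof (rule face_colours_eq_gap_faces[OF ijk(1,2) \<open>finite B\<close>])
      show "B \<inter> {i,j,k} = {}" using B by blast
      fix x y C assume xy: "x < y" "{x,y} \<subseteq> {i,j,k}" and C: "B \<subseteq> C" "C \<subseteq> B \<union> ({i,j,k} - {x,y})"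
      have "{x,y} \<subseteq> H" using xy(2) ijk(3) by (rule subset_trans)
      moreover have "B \<inter> {x,y} = {}" using xy(2) B by blast
      then have "C \<subseteq> H - {x,y}" using C(2) B ijk(3) by blast
      ultimately show "g {x,y} C =
          F (card {z\<in>C. z < x}) (card {z\<in>C. x < z \<and> z < y}) (card {z\<in>C. y < z})"
        using F xy(1) by simp
    qed
    then have eq: "gap_faces F a b c d =
        {g T C |T C. T \<subseteq> {i,j,k} \<and> card T = 2 \<and> B \<subseteq> C \<and> C \<subseteq> B \<union> ({i,j,k} - T)}"
      by (simp only: gaps)
    show ?thesis
    proof
      fix l :: nat assume "l \<in> {..<4}"
      then have "l < r" using \<open>\<not> r \<le> 3\<close> by simp
      then have "\<exists>T C. T \<subseteq> {i,j,k} \<and> card T = 2 \<and> B \<subseteq> C \<and> C \<subseteq> B \<union> ({i,j,k} - T) \<and> g T C = l"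
        by (rule poly[THEN spec, THEN spec, THEN mp, OF face, THEN spec, THEN mp])
      then obtain T C where "T \<subseteq> {i,j,k} \<and> card T = 2 \<and> B \<subseteq> C \<and> C \<subseteq> B \<union> ({i,j,k} - T)"
        "l = g T C" by (elim exE conjE) simp
      then show "l \<in> gap_faces F a b c d"
        unfolding eq mem_Collect_eq by (intro exI[of _ T] exI[of _ C] conjI) simp_all
    qed
  qed
  then show False by (rule not_four_gap_faces)
qed

theorem theorem21:
  shows "polychromatic_number 2 3 = 3"
  unfolding polychromatic_number_def
proof (rule Greatest_equality)
  show "\<forall>n\<ge>3. \<exists>c. polychromatic_colouring 2 3 n 3 c"
    by (intro allI impI ex_three_colouring)
qed (rule colours_le_three)

end
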